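(* (a) Let $\langle K,R,\vDash\rangle$ be a Kripke model such that for every $k\in K$: $xRx$ for all $x\in R^+[k]$, and $\vDash$ restricted to $R^+[k]$ is formula persistent (for all $x,y\in R^+[k]$ with $xRy$ and every formula $\chi$, $x\vDash\chi$ implies $y\vDash\chi$). Then for all formulas $\varphi,\psi$, the formula $(\varphi\&[\varphi\rightarrow\psi])\rightarrow(\psi\&[\psi\rightarrow\varphi])$ holds at every node of this model. (b) Conversely, suppose the axiom scheme $(\varphi\&[\varphi\rightarrow\psi])\rightarrow(\psi\&[\psi\rightarrow\varphi])$ is satisfied in a Kripke frame $\langle K,R\rangle$ (every instance holds at every node of every Kripke model on the frame). Then for every $k\in K$, $xRx$ holds for all $x\in R^+[k]$; and every Kripke model on this frame in which that scheme holds at every node has a satisfaction relation whose restriction to $R^+[k]$ is formula persistent for every $k\in K$.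
   Context: Formulas are built from a countably infinite set of atoms and the constant $\bot$ (falsity) using the binary connectives $\&$ and $\rightarrow$. A Kripke frame is a pair $\langle K,R\rangle$ with $R\subseteq K\times K$ an arbitrary binary relation; a Kripke model on it is $\langle K,R,\vDash\rangle$ with $\vDash\subseteq K\times\mathsf{Atoms}$ arbitrary, extended to formulas by: $k\nvDash\bot$; $k\vDash\varphi\&\psi$ iff $k\vDash\varphi$ and $k\vDash\psi$; $k\vDash\varphi\rightarrow\psi$ iff for every $k'$ with $kRk'$, if $k'\vDash\varphi$ then $k'\vDash\psi$. For $k\in K$, $R^n[k]=\{x\mid \exists y_1,\dots,y_{n-1}\,(kRy_1R\cdots Ry_{n-1}Rx)\}$ and $R^+[k]=\bigcup_{n\ge1}R^n[k]$. *)

theory Defs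
  imports Main
begin

datatype form =
    Atom nat
  | Bot  ("\<^bold>\<bottom>")
  | Conj form form  (infixr "\<^bold>&" 65)
  | Impl form form  (infixr "\<^bold>\<rightarrow>" 60)

definition kripke_frame :: "'w set \<Rightarrow> ('w \<times> 'w) set \<Rightarrow> bool" where
  "kripke_frame K R \<longleftrightarrow> R \<subseteq> K \<times> K"

text \<open>Atoms are identified with natural numbers; \<open>V\<close> is the satisfaction relation on atoms.\<close>

definition kripke_model :: "'w set \<Rightarrow> ('w \<times> 'w) set \<Rightarrow> ('w \<times> nat) set \<Rightarrow> bool" where
  "kripke_model K R V \<longleftrightarrow> kripke_frame K R \<and> V \<subseteq> K \<times> UNIV"

text \<open>The carrier is not a parameter: in a frame, every successor lies in \<open>K\<close>.\<close>

fun sat :: "('w \<times> 'w) set \<Rightarrow> ('w \<times> nat) set \<Rightarrow> 'w \<Rightarrow> form \<Rightarrow> bool" where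
  "sat R V k (Atom p) \<longleftrightarrow> (k, p) \<in> V"
| "sat R V k \<^bold>\<bottom> \<longleftrightarrow> False"
| "sat R V k (\<phi> \<^bold>& \<psi>) \<longleftrightarrow> sat R V k \<phi> \<and> sat R V k \<psi>"
| "sat R V k (\<phi> \<^bold>\<rightarrow> \<psi>) \<longleftrightarrow> (\<forall>k'. (k, k') \<in> R \<longrightarrow> sat R V k' \<phi> \<longrightarrow> sat R V k' \<psi>)"

definition Rpow :: "('w \<times> 'w) set \<Rightarrow> nat \<Rightarrow> 'w \<Rightarrow> 'w set" where
  "Rpow R n k = {x. (k, x) \<in> R ^^ n}"

definition Rplus :: "('w \<times> 'w) set \<Rightarrow> 'w \<Rightarrow> 'w set" where
  "Rplus R k = (\<Union>n\<in>{1..}. Rpow R n k)"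

definition formula_persistent_on ::
    "'w set \<Rightarrow> ('w \<times> 'w) set \<Rightarrow> ('w \<times> nat) set \<Rightarrow> bool" where
  "formula_persistent_on A R V \<longleftrightarrow>
     (\<forall>x\<in>A. \<forall>y\<in>A. (x, y) \<in> R \<longrightarrow> (\<forall>\<chi>. sat R V x \<chi> \<longrightarrow> sat R V y \<chi>))"

definition scheme_instance :: "form \<Rightarrow> form \<Rightarrow> form" where
  "scheme_instance \<phi> \<psi> = ((\<phi> \<^bold>& (\<phi> \<^bold>\<rightarrow> \<psi>)) \<^bold>\<rightarrow> (\<psi> \<^bold>& (\<psi> \<^bold>\<rightarrow> \<phi>)))"

definition scheme_holds_in_model ::
    "'w set \<Rightarrow> ('w \<times> 'w) set \<Rightarrow> ('w \<times> nat) set \<Rightarrow> bool" where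
  "scheme_holds_in_model K R V \<longleftrightarrow> (\<forall>\<phi> \<psi>. \<forall>k\<in>K. sat R V k (scheme_instance \<phi> \<psi>))"

definition scheme_satisfied_in_frame :: "'w set \<Rightarrow> ('w \<times> 'w) set \<Rightarrow> bool" where
  "scheme_satisfied_in_frame K R \<longleftrightarrow>
     (\<forall>V. kripke_model K R V \<longrightarrow> scheme_holds_in_model K R V)"

end

theory Submission
  imports Defs
begin

text \<open>
  Reflexivity at a point \<open>x\<close> with a predecessor is forced by the instance
  \<open>\<phi> = p\<close>, \<open>\<psi> = \<bottom>\<close> under the valuation making \<open>p\<close> true exactly at \<open>x\<close>: if \<open>x\<close> does not see
  itself, then \<open>p \<rightarrow> \<bottom>\<close> holds at \<open>x\<close>, and so would \<open>\<bottom>\<close>. Persistence of \<open>\<chi>\<close> is the instance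
  \<open>\<phi> = \<chi>\<close>, \<open>\<psi> = (\<bottom> \<rightarrow> \<bottom>)\<close>.
\<close>

lemma Rplus_eq_trancl_Image: "Rplus R k = R\<^sup>+ `` {k}"
  by (fastforce simp: Rplus_def Rpow_def trancl_power Suc_le_eq)

text \<open>An implication at a node constrains only its successors, so the scheme can be exploited
  at \<open>x\<close> only through some node that sees \<open>x\<close>. The last edge of a path
  from \<open>k\<close> to \<open>x\<close> supplies one.\<close>

lemma Rplus_predecessor:
  assumes "kripke_frame K R" "x \<in> Rplus R k"
  obtains z where "z \<in> K" "(z, x) \<in> R"
proof -
  from assms(2) have "(k, x) \<in> R\<^sup>+"
    by (simp add: Rplus_eq_trancl_Image)
  then obtain z where "(z, x) \<in> R"
    by (meson tranclE)
  with assms(1) that show thesis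
    unfolding kripke_frame_def by blast
qed

text \<open>The scheme at \<open>z\<close> is an implication, and the edge to \<open>x\<close>
  transfers it into a rule of inference at \<open>x\<close>.\<close>

lemma sat_scheme_instanceD:
  assumes "scheme_holds_in_model K R V" "z \<in> K" "(z, x) \<in> R"
    and "sat R V x \<phi>" "sat R V x (\<phi> \<^bold>\<rightarrow> \<psi>)"
  shows "sat R V x \<psi>" "sat R V x (\<psi> \<^bold>\<rightarrow> \<phi>)"
proof -
  have "sat R V z (scheme_instance \<phi> \<psi>)"
    using assms(1,2) by (simp add: scheme_holds_in_model_def)
  then have "sat R V x (\<psi> \<^bold>& (\<psi> \<^bold>\<rightarrow> \<phi>))"
    using assms(3-) unfolding scheme_instance_def sat.simps by blast
  then show "sat R V x \<psi>" "sat R V x (\<psi> \<^bold>\<rightarrow> \<phi>)"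
    by simp_all
qed

text \<open>At a successor \<open>x\<close> of \<open>k\<close>, reflexivity permits modus ponens
  and yields \<psi>. Persistence carries \<phi> from \<open>x\<close> to all its successors, which
  makes \<psi> \<rightarrow> \<phi> true at \<open>x\<close> whatever \<psi> is.\<close>

lemma sat_scheme_instance:
  assumes refl: "\<forall>x\<in>Rplus R k. (x, x) \<in> R"
    and pers: "formula_persistent_on (Rplus R k) R V"
  shows "sat R V k (scheme_instance \<phi> \<psi>)"
proof -
  have "sat R V x (\<psi> \<^bold>& (\<psi> \<^bold>\<rightarrow> \<phi>))"
    if kx: "(k, x) \<in> R" and phi: "sat R V x \<phi>" and imp: "sat R V x (\<phi> \<^bold>\<rightarrow> \<psi>)" for x
  proof -
    have x: "x \<in> Rplus R k"
      using kx by (auto simp: Rplus_eq_trancl_Image)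
    have "sat R V x \<psi>"
      using refl x phi imp by auto
    moreover have "sat R V y \<phi>" if xy: "(x, y) \<in> R" for y
    proof -
      have "y \<in> Rplus R k"
        using kx xy by (auto simp: Rplus_eq_trancl_Image)
      then show ?thesis
        using pers x xy phi unfolding formula_persistent_on_def by blast
    qed
    ultimately show ?thesis
      by simp
  qed
  then show ?thesis
    unfolding scheme_instance_def sat.simps(3,4) by blast
qed

lemma scheme_satisfied_in_frame_refl:
  assumes frame: "kripke_frame K R" and scheme: "scheme_satisfied_in_frame K R"
    and x: "x \<in> Rplus R k"
  shows "(x, x) \<in> R"
proof (rule ccontr)
  assume nrefl: "(x, x) \<notin> R"
  obtain z where z: "z \<in> K" "(z, x) \<in> R"
    using Rplus_predecessor[OF frame x] .
  let ?V = "{(x, 0::nat)}"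
  \<comment> \<open>The edge from \<open>z\<close> places \<open>x\<close> in \<open>K\<close>, so
    \<open>?V\<close> is a valuation on the frame.\<close>
  have "kripke_model K R ?V"
    using frame z by (auto simp: kripke_model_def kripke_frame_def)
  then have "scheme_holds_in_model K R ?V"
    using scheme by (simp add: scheme_satisfied_in_frame_def)
  moreover have "sat R ?V x (Atom 0)" "sat R ?V x (Atom 0 \<^bold>\<rightarrow> \<^bold>\<bottom>)"
    using nrefl by auto
  ultimately have "sat R ?V x \<^bold>\<bottom>"
    by (rule sat_scheme_instanceD(1)[OF _ z])
  then show False
    by simp
qed

lemma scheme_holds_in_model_persistent:
  assumes frame: "kripke_frame K R" and scheme: "scheme_holds_in_model K R V"
  shows "formula_persistent_on (Rplus R k) R V"
  unfolding formula_persistent_on_def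
proof (intro ballI impI allI)
  fix x y \<chi>
  assume x: "x \<in> Rplus R k" and xy: "(x, y) \<in> R" and chi: "sat R V x \<chi>"
  obtain z where z: "z \<in> K" "(z, x) \<in> R"
    using Rplus_predecessor[OF frame x] .
  \<comment> \<open>The formula \<bottom> \<rightarrow> \<bottom> acts as truth: it holds at every
    node, so the converse implication at \<open>x\<close> says that \<chi> holds at all successors
    of \<open>x\<close>.\<close>
  have "sat R V x (\<chi> \<^bold>\<rightarrow> (\<^bold>\<bottom> \<^bold>\<rightarrow> \<^bold>\<bottom>))"
    by simp
  from sat_scheme_instanceD(2)[OF scheme z chi this] show "sat R V y \<chi>"
    using xy by simp
qed

theorem theorem3:
  fixes K :: "'w set" and R :: "('w \<times> 'w) set"
  shows
    "(\<forall>V. kripke_model K R V \<longrightarrow>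
        (\<forall>k\<in>K. (\<forall>x\<in>Rplus R k. (x, x) \<in> R) \<and> formula_persistent_on (Rplus R k) R V) \<longrightarrow>
        (\<forall>\<phi> \<psi>. \<forall>k\<in>K. sat R V k ((\<phi> \<^bold>& (\<phi> \<^bold>\<rightarrow> \<psi>)) \<^bold>\<rightarrow> (\<psi> \<^bold>& (\<psi> \<^bold>\<rightarrow> \<phi>)))))
     \<and>
     (kripke_frame K R \<longrightarrow> scheme_satisfied_in_frame K R \<longrightarrow>
        (\<forall>k\<in>K. \<forall>x\<in>Rplus R k. (x, x) \<in> R) \<and>
        (\<forall>V. kripke_model K R V \<longrightarrow> scheme_holds_in_model K R V \<longrightarrow>
           (\<forall>k\<in>K. formula_persistent_on (Rplus R k) R V)))"
proof (intro conjI impI allI ballI)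
  fix V \<phi> \<psi> k
  assume "\<forall>k\<in>K. (\<forall>x\<in>Rplus R k. (x, x) \<in> R) \<and> formula_persistent_on (Rplus R k) R V"
    and "k \<in> K"
  then show "sat R V k ((\<phi> \<^bold>& (\<phi> \<^bold>\<rightarrow> \<psi>)) \<^bold>\<rightarrow> (\<psi> \<^bold>& (\<psi> \<^bold>\<rightarrow> \<phi>)))"
    by (intro sat_scheme_instance[unfolded scheme_instance_def]) simp_all
qed (erule (2) scheme_satisfied_in_frame_refl, erule (1) scheme_holds_in_model_persistent)

end
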